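(* Let $V$ be a finite-dimensional complex vector space and let $T:V\to V$ be a nilpotent linear operator. For $m\ge 0$ let $K_m=\ker(T^m)$. A $q$-basis $B$ has minimum weight if and only if $q(B\cap K_m)$ spans $q(K_m)$ for all $m$.
   Context: Let $q:V\to V/\operatorname{Im}(T)$ be the canonical projection. A $q$-basis is a subset $B\subseteq V$ that $q$ maps (bijectively) onto a basis of $V/\operatorname{Im}(T)$. For $v\in V$ let $\mathbf K(v)$ be the least nonnegative integer $m$ with $T^m v=0$. The weight of a finite set $B\subseteq V$ is $\sum_{b\in B}\mathbf K(b)$; a $q$-basis has minimum weight if its weight is minimal among all $q$-bases. *)

theory Defs
  imports Complex_Main "HOL-Algebra.AbelCoset" "Jordan_Normal_Form.VS_Connect"
begin

text \<open>
  Vector spaces are the carrier-based ones of \<open>vectorspace K V\<close> (a module record over a field record),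
  with \<open>LinearCombinations.module.span\<close> and \<open>vectorspace.basis\<close>; this makes the set of cosets
  \<open>V / U\<close> itself a vector space. The field of complex numbers is \<open>class_ring :: complex ring\<close>.
\<close>

text \<open>
  The fields \<open>mult\<close> and \<open>one\<close> are only present because module records extend ring records;
  they play no role in \<open>vectorspace\<close>. As a subset of \<open>V\<close>, the coset \<open>c \<cdot> X\<close> has to be
  \<open>\<Union>x\<in>X. U + c \<cdot> x\<close>, since for \<open>c = 0\<close> the elementwise multiple of \<open>X\<close> is not a coset.
\<close>

definition quot_space :: "('k, 'v, 'm) module_scheme \<Rightarrow> 'v set \<Rightarrow> ('k, 'v set) module" where
  "quot_space V U =
    \<lparr>carrier = a_rcosets\<^bsub>V\<^esub> U, mult = undefined, one = undefined, zero = U, add = set_add V,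
     smult = (\<lambda>c X. \<Union>x\<in>X. U +>\<^bsub>V\<^esub> (c \<odot>\<^bsub>V\<^esub> x))\<rparr>"

lemma quot_space_vectorspace:
  fixes K :: "('k, 'r) ring_scheme" and V :: "('k, 'v, 'm) module_scheme"
  assumes "vectorspace K V" "submodule K U V"
  shows "vectorspace K (quot_space V U)"
proof -
  interpret vectorspace K V by fact
  note smult_in = smult_closed
  interpret submodule K U V by fact
  have ab: "abelian_subgroup U V"
  proof (rule abelian_subgroupI3)
    show "additive_subgroup U V"
    proof (rule additive_subgroupI)
      show "subgroup U (add_monoid V)"
      proof
        fix x assume x: "x \<in> U"
        have "(\<ominus>\<^bsub>K\<^esub> \<one>\<^bsub>K\<^esub>) \<odot>\<^bsub>V\<^esub> x = \<ominus>\<^bsub>V\<^esub> x"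
          using x subset by (metis R.one_closed smult_l_minus smult_one subsetD)
        then show "inv\<^bsub>add_monoid V\<^esub> x \<in> U" using smult_closed x
          by (metis R.a_inv_closed R.one_closed a_inv_def)
      qed (use subset in auto)
    qed
  qed (rule M.abelian_group_axioms)
  interpret abelian_subgroup U V by fact
  have carr: "carrier (quot_space V U) = (\<lambda>v. U +>\<^bsub>V\<^esub> v) ` carrier V"
    by (auto simp: quot_space_def A_RCOSETS_def')
  have sm: "c \<odot>\<^bsub>quot_space V U\<^esub> (U +>\<^bsub>V\<^esub> v) = U +>\<^bsub>V\<^esub> (c \<odot>\<^bsub>V\<^esub> v)"
    if "c \<in> carrier K" "v \<in> carrier V" for c v
  proof -
    have A: "U +>\<^bsub>V\<^esub> (c \<odot>\<^bsub>V\<^esub> x) = U +>\<^bsub>V\<^esub> (c \<odot>\<^bsub>V\<^esub> v)" if x: "x \<in> U +>\<^bsub>V\<^esub> v" for x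
    proof -
      obtain u where u: "u \<in> U" "x = u \<oplus>\<^bsub>V\<^esub> v" using x by (auto simp: a_r_coset_def')
      have "c \<odot>\<^bsub>V\<^esub> x = c \<odot>\<^bsub>V\<^esub> u \<oplus>\<^bsub>V\<^esub> c \<odot>\<^bsub>V\<^esub> v"
        using u subset \<open>c \<in> _\<close> \<open>v \<in> _\<close> by (auto simp: smult_r_distr)
      then have "c \<odot>\<^bsub>V\<^esub> x \<in> U +>\<^bsub>V\<^esub> (c \<odot>\<^bsub>V\<^esub> v)"
        using u \<open>c \<in> _\<close> by (auto simp: a_r_coset_def')
      then show ?thesis
        using a_repr_independence' \<open>c \<in> _\<close> \<open>v \<in> _\<close> by (metis smult_in)
    qed
    have B: "v \<in> U +>\<^bsub>V\<^esub> v" using that a_rcos_self by blast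
    have "(\<Union>x\<in>U +>\<^bsub>V\<^esub> v. U +>\<^bsub>V\<^esub> (c \<odot>\<^bsub>V\<^esub> x)) = U +>\<^bsub>V\<^esub> (c \<odot>\<^bsub>V\<^esub> v)"
    proof (rule SUP_eq_const)
      show "U +>\<^bsub>V\<^esub> v \<noteq> {}" using B by blast
    qed (rule A)
    then show ?thesis by (simp only: quot_space_def module.simps)
  qed
  have ad: "(U +>\<^bsub>V\<^esub> v) \<oplus>\<^bsub>quot_space V U\<^esub> (U +>\<^bsub>V\<^esub> w) = U +>\<^bsub>V\<^esub> (v \<oplus>\<^bsub>V\<^esub> w)"
    if "v \<in> carrier V" "w \<in> carrier V" for v w
    using that by (simp add: quot_space_def a_rcos_sum)
  have z: "\<zero>\<^bsub>quot_space V U\<^esub> = U +>\<^bsub>V\<^esub> \<zero>\<^bsub>V\<^esub>"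
    using subset by (simp add: quot_space_def)
  have "abelian_group (quot_space V U)"
  proof (rule abelian_groupI)
    fix x assume "x \<in> carrier (quot_space V U)"
    then obtain v where v: "v \<in> carrier V" "x = U +>\<^bsub>V\<^esub> v" by (auto simp: carr)
    then show "\<exists>y\<in>carrier (quot_space V U). y \<oplus>\<^bsub>quot_space V U\<^esub> x = \<zero>\<^bsub>quot_space V U\<^esub>"
      by (intro bexI[of _ "U +>\<^bsub>V\<^esub> (\<ominus>\<^bsub>V\<^esub> v)"]) (auto simp: ad z carr M.l_neg)
  qed (auto simp: carr ad z M.a_assoc M.a_comm M.add.m_lcomm)
  moreover have "cring K" by unfold_locales
  ultimately have "Module.module K (quot_space V U)"
    by (intro moduleI) (auto simp: carr ad sm smult_l_distr smult_r_distr smult_assoc1 smult_in)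
  then show ?thesis by (simp add: vectorspace_def field_axioms)
qed

definition quot_proj :: "('k, 'v, 'm) module_scheme \<Rightarrow> 'v set \<Rightarrow> 'v \<Rightarrow> 'v set" where
  "quot_proj V U v = U +>\<^bsub>V\<^esub> v"

definition nilpotent_on :: "('k, 'v, 'm) module_scheme \<Rightarrow> ('v \<Rightarrow> 'v) \<Rightarrow> bool" where
  "nilpotent_on V T \<longleftrightarrow> (\<exists>n. \<forall>v\<in>carrier V. (T ^^ n) v = \<zero>\<^bsub>V\<^esub>)"

abbreviation im_quot :: "('k, 'v, 'm) module_scheme \<Rightarrow> ('v \<Rightarrow> 'v) \<Rightarrow> ('k, 'v set) module" where
  "im_quot V T \<equiv> quot_space V (mod_hom.im V T)"

abbreviation im_proj :: "('k, 'v, 'm) module_scheme \<Rightarrow> ('v \<Rightarrow> 'v) \<Rightarrow> 'v \<Rightarrow> 'v set" where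
  "im_proj V T \<equiv> quot_proj V (mod_hom.im V T)"

abbreviation ker_pow :: "('k, 'v, 'm) module_scheme \<Rightarrow> ('v \<Rightarrow> 'v) \<Rightarrow> nat \<Rightarrow> 'v set" where
  "ker_pow V T m \<equiv> mod_hom.ker V V (T ^^ m)"

definition q_basis :: "(complex, 'v, 'm) module_scheme \<Rightarrow> ('v \<Rightarrow> 'v) \<Rightarrow> 'v set \<Rightarrow> bool" where
  "q_basis V T B \<longleftrightarrow> B \<subseteq> carrier V \<and> inj_on (im_proj V T) B \<and>
     vectorspace.basis class_ring (im_quot V T) (im_proj V T ` B)"

definition nil_height :: "('k, 'v, 'm) module_scheme \<Rightarrow> ('v \<Rightarrow> 'v) \<Rightarrow> 'v \<Rightarrow> nat" where
  "nil_height V T v = (LEAST m. (T ^^ m) v = \<zero>\<^bsub>V\<^esub>)"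

definition weight :: "('k, 'v, 'm) module_scheme \<Rightarrow> ('v \<Rightarrow> 'v) \<Rightarrow> 'v set \<Rightarrow> nat" where
  "weight V T B = (\<Sum>b\<in>B. nil_height V T b)"

text \<open>If \<open>V\<close> is finite-dimensional, every q-basis is finite, so only weights of finite sets are compared.\<close>

definition has_min_weight :: "(complex, 'v, 'm) module_scheme \<Rightarrow> ('v \<Rightarrow> 'v) \<Rightarrow> 'v set \<Rightarrow> bool" where
  "has_min_weight V T B \<longleftrightarrow>
     q_basis V T B \<and> (\<forall>B'. q_basis V T B' \<longrightarrow> weight V T B \<le> weight V T B')"

end

theory Submission
  imports Defs
begin

text \<open>
  The weight of a q-basis \<open>B\<close> is the sum over \<open>m\<close> of the number of elements of \<open>B\<close> outside \<open>K\<^sub>m\<close>.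
  If \<open>q(B \<inter> K\<^sub>m)\<close> spans \<open>q(K\<^sub>m)\<close> for every \<open>m\<close>, then every other q-basis has at most as many elements
  in each \<open>K\<^sub>m\<close>, by linear independence, so \<open>B\<close> has minimum weight. If some \<open>q(v)\<close> with \<open>v \<in> K\<^sub>m\<close>
  is not in the span of \<open>q(B \<inter> K\<^sub>m)\<close>, then \<open>v\<close> can replace an element of \<open>B\<close> outside \<open>K\<^sub>m\<close>,
  which lowers the weight.
\<close>

section \<open>Exchange and replacement in bases\<close>

context vectorspace
begin

text \<open>Choose \<open>D\<close> inclusion-minimal in \<open>A\<close> with \<open>w\<close> in
  its span. Since \<open>w\<close> is outside \<open>span S\<close>, some \<open>b\<close> in
  \<open>D\<close> lies outside \<open>S\<close>. By minimality \<open>w\<close> really involves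
  \<open>b\<close>, so \<open>w\<close> can take the place of \<open>b\<close>.\<close>

lemma basis_exchange_outside_span:
  assumes "basis A" "finite A" "S \<subseteq> A" "w \<in> carrier V" "w \<notin> span S"
  obtains b where "b \<in> A - S" "w \<notin> A - {b}" "basis (insert w (A - {b}))"
proof -
  have A: "lin_indpt A" "span A = carrier V" "A \<subseteq> carrier V"
    using \<open>basis A\<close> by (auto simp: basis_def)
  obtain D where "D \<subseteq> A" "minimal D (\<lambda>D. w \<in> span D)"
    using minimal_exists[of A "\<lambda>D. w \<in> span D"] assms A by auto
  then have D: "D \<subseteq> A" "w \<in> span D"
    and D_min: "\<And>E. E \<subseteq> D \<Longrightarrow> w \<in> span E \<Longrightarrow> E = D"
    by (auto simp: minimal_def)
  have DV: "D \<subseteq> carrier V" using D A by auto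
  have "\<not> D \<subseteq> S" using D assms span_is_monotone by blast
  then obtain b where b: "b \<in> D" "b \<notin> S" by auto
  define E where "E = D - {b}"
  have D_eq: "D = insert b E" and bE: "b \<notin> E" using b by (auto simp: E_def)
  have wE: "w \<notin> span E" using D_min[of E] b by (auto simp: E_def)
  have EV: "E \<subseteq> carrier V" "b \<in> carrier V" using DV D_eq by auto
  have "lin_indpt D" using subset_li_is_li[OF A(1) D(1)] .
  then have liE: "lin_indpt E" by (rule subset_li_is_li) (auto simp: E_def)
  have "w \<notin> E" using wE EV span_mem by blast
  then have liwE: "lin_indpt (insert w E)"
    using lin_dep_iff_in_span[OF EV(1) liE assms(4)] wE by auto
  \<comment> \<open>If \<open>b\<close> and \<open>w\<close> differ, adding \<open>w\<close> to
    \<open>D\<close> gives a dependent set, which is also \<open>insert w E\<close> together with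
    \<open>b\<close>. As \<open>insert w E\<close> is independent, \<open>b\<close> lies in its
    span.\<close>
  have b_span: "b \<in> span (insert w E)"
  proof (cases "b = w")
    case True
    then show ?thesis using EV by (auto intro!: span_mem)
  next
    case False
    have "w \<notin> D" using False \<open>w \<notin> E\<close> D_eq by auto
    then have "lin_dep (insert b (insert w E))"
      using lin_dep_iff_in_span[OF DV \<open>lin_indpt D\<close> assms(4)] D D_eq by (simp add: insert_commute)
    then show ?thesis
      using lin_dep_iff_in_span[OF _ liwE EV(2)] False bE EV assms(4) by auto
  qed
  have b_span': "b \<in> span (insert w (A - {b}))"
  proof -
    have "insert w E \<subseteq> insert w (A - {b})" using D by (auto simp: E_def)
    then show ?thesis using b_span span_is_monotone by blast
  qed
  have bA: "insert b (A - {b}) = A" using b D by auto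
  \<comment> \<open>Otherwise \<open>b\<close> would lie in the span of the other elements of
    \<open>A\<close>, against independence. So the exchange preserves the number of
    elements.\<close>
  have "w \<notin> A - {b}"
  proof
    assume "w \<in> A - {b}"
    then have "b \<in> span (A - {b})" using b_span' by (simp add: insert_absorb)
    moreover have "lin_indpt (A - {b})" using subset_li_is_li[OF A(1)] by blast
    ultimately show False
      using lin_dep_iff_in_span[of "A - {b}" b] A EV bA by auto
  qed
  moreover have "basis (insert w (A - {b}))"
    by (rule basis_swap[of "A - {b}" b]) (use assms EV bA b_span' in auto)
  moreover have "b \<in> A - S" using b D by auto
  ultimately show thesis using that by blast
qed

lemma lin_indpt_card_le_span:
  assumes "lin_indpt A" "finite A" "finite S" "S \<subseteq> carrier V" "A \<subseteq> span S"
  shows "card A \<le> card S"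
  \<comment> \<open>The set completing \<open>A\<close> to a spanning set has at most
    \<open>card S - card A\<close> elements, as an integer, so this difference is
    nonnegative.\<close>
  using replacement[OF assms(2,3,4,1,5)] by (elim exE conjE) linarith

end

section \<open>Linear maps, their powers and the quotient projection\<close>

lemma (in mod_hom) submodule_image:
  assumes "submodule R U M"
  shows "submodule R (f ` U) N"
proof -
  interpret U: submodule R U M by fact
  have UM: "x \<in> carrier M" if "x \<in> U" for x using that U.subset by auto
  show ?thesis
  proof
    show "f ` U \<subseteq> carrier N" using UM by auto
  next
    fix v w assume "v \<in> f ` U" "w \<in> f ` U"
    then show "v \<oplus>\<^bsub>N\<^esub> w \<in> f ` U" using UM U.m_closed by (auto simp flip: f_add)
  next
    show "\<zero>\<^bsub>N\<^esub> \<in> f ` U" using U.zero_closed f0_is_0 by (metis image_eqI)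
  next
    fix c v assume "c \<in> carrier R" "v \<in> f ` U"
    then show "c \<odot>\<^bsub>N\<^esub> v \<in> f ` U" using UM U.smult_closed by (auto simp flip: f_smult)
  qed
qed

lemma linear_map_funpow:
  assumes "linear_map K V V T"
  shows "linear_map K V V (T ^^ m)"
proof -
  interpret linear_map K V V T by fact
  have "T ^^ m \<in> LinearCombinations.module_hom K V V"
  proof (induction m)
    case (Suc m)
    have closed: "(T ^^ m) v \<in> carrier V" if "v \<in> carrier V" for v
      using Suc that by (auto simp: LinearCombinations.module_hom_def)
    have add: "(T ^^ m) (v \<oplus>\<^bsub>V\<^esub> w) = (T ^^ m) v \<oplus>\<^bsub>V\<^esub> (T ^^ m) w"
      if "v \<in> carrier V" "w \<in> carrier V" for v w
      using Suc that by (auto simp: LinearCombinations.module_hom_def)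
    have smult: "(T ^^ m) (c \<odot>\<^bsub>V\<^esub> v) = c \<odot>\<^bsub>V\<^esub> (T ^^ m) v"
      if "c \<in> carrier K" "v \<in> carrier V" for c v
      using Suc that by (auto simp: LinearCombinations.module_hom_def)
    show ?case
      by (auto simp: LinearCombinations.module_hom_def closed add smult)
  qed (auto simp: LinearCombinations.module_hom_def)
  then show ?thesis
    using assms by (simp add: linear_map_def mod_hom_def mod_hom_axioms_def)
qed

lemma linear_map_quot_proj:
  assumes "vectorspace K V" "submodule K U V"
  shows "linear_map K V (quot_space V U) (quot_proj V U)"
proof -
  interpret V: vectorspace K V by fact
  interpret U: submodule K U V by fact
  interpret Q: vectorspace K "quot_space V U" by (rule quot_space_vectorspace[OF assms])
  \<comment> \<open>Closure under negation comes from scaling by minus one; it makes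
    \<open>U\<close> an additive subgroup, so that the coset lemmas apply.\<close>
  have neg: "\<ominus>\<^bsub>V\<^esub> x \<in> U" if "x \<in> U" for x
    using that U.smult_closed[of "\<ominus>\<^bsub>K\<^esub> \<one>\<^bsub>K\<^esub>" x] U.subset
    by (metis V.R.a_inv_closed V.R.one_closed V.smult_l_minus V.smult_one subsetD)
  have "additive_subgroup U V"
  proof (rule additive_subgroupI)
    show "subgroup U (add_monoid V)"
      by unfold_locales (use neg U.subset in \<open>auto simp flip: a_inv_def\<close>)
  qed
  then interpret A: abelian_subgroup U V
    by (rule abelian_subgroupI3) (rule V.M.abelian_group_axioms)
  have smult: "c \<odot>\<^bsub>quot_space V U\<^esub> (U +>\<^bsub>V\<^esub> v) = U +>\<^bsub>V\<^esub> (c \<odot>\<^bsub>V\<^esub> v)"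
    if "c \<in> carrier K" "v \<in> carrier V" for c v
  proof -
    \<comment> \<open>The union that defines scaling in the quotient runs over equal cosets, so it
      collapses to one of them.\<close>
    have "U +>\<^bsub>V\<^esub> (c \<odot>\<^bsub>V\<^esub> x) = U +>\<^bsub>V\<^esub> (c \<odot>\<^bsub>V\<^esub> v)" if x: "x \<in> U +>\<^bsub>V\<^esub> v" for x
    proof -
      obtain u where u: "u \<in> U" "x = u \<oplus>\<^bsub>V\<^esub> v" using x by (auto simp: a_r_coset_def')
      then have "c \<odot>\<^bsub>V\<^esub> x = c \<odot>\<^bsub>V\<^esub> u \<oplus>\<^bsub>V\<^esub> c \<odot>\<^bsub>V\<^esub> v"
        using U.subset \<open>c \<in> _\<close> \<open>v \<in> _\<close> by (auto simp: V.smult_r_distr)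
      then have "c \<odot>\<^bsub>V\<^esub> x \<in> U +>\<^bsub>V\<^esub> (c \<odot>\<^bsub>V\<^esub> v)"
        using u \<open>c \<in> _\<close> by (auto simp: a_r_coset_def')
      then show ?thesis
        using A.a_repr_independence' \<open>c \<in> _\<close> \<open>v \<in> _\<close> by (metis V.smult_closed)
    qed
    moreover have "U +>\<^bsub>V\<^esub> v \<noteq> {}" using A.a_rcos_self that by blast
    ultimately have "(\<Union>x\<in>U +>\<^bsub>V\<^esub> v. U +>\<^bsub>V\<^esub> (c \<odot>\<^bsub>V\<^esub> x)) = U +>\<^bsub>V\<^esub> (c \<odot>\<^bsub>V\<^esub> v)"
      by (intro SUP_eq_const)
    then show ?thesis by (simp only: quot_space_def module.simps)
  qed
  show ?thesis
    by unfold_locales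
      (auto simp: LinearCombinations.module_hom_def quot_proj_def smult,
       auto simp: quot_space_def A_RCOSETS_def' A.a_rcos_sum)
qed

lemma quot_proj_surj: "quot_proj V U ` carrier V = carrier (quot_space V U)"
  by (auto simp: quot_space_def quot_proj_def A_RCOSETS_def')

text \<open>Double counting: \<open>h b\<close> is the number of \<open>m\<close> below
  \<open>N\<close> with \<open>m < h b\<close>, and the two summations are swapped.\<close>

lemma sum_eq_sum_card_less:
  fixes h :: "'a \<Rightarrow> nat"
  assumes "finite B" "\<And>b. b \<in> B \<Longrightarrow> h b \<le> N"
  shows "(\<Sum>b\<in>B. h b) = (\<Sum>m<N. card {b\<in>B. m < h b})"
proof -
  have "(\<Sum>b\<in>B. h b) = (\<Sum>b\<in>B. \<Sum>m<N. if m < h b then 1 else 0)"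
  proof (rule sum.cong)
    fix b assume "b \<in> B"
    then have "{..<N} \<inter> {m. m < h b} = {..<h b}" using assms(2)[of b] by auto
    then show "h b = (\<Sum>m<N. if m < h b then 1 else 0)" by (simp add: sum.If_cases)
  qed simp
  also have "\<dots> = (\<Sum>m<N. \<Sum>b\<in>B. if m < h b then 1 else 0)" by (rule sum.swap)
  also have "\<dots> = (\<Sum>m<N. card {b\<in>B. m < h b})"
    using assms(1) by (simp add: sum.If_cases Int_def)
  finally show ?thesis .
qed

section \<open>Lifts of bases along a linear map\<close>

context linear_map
begin

text \<open>This generalizes q-bases. In this context \<open>T\<close> is the map along which bases
  are lifted; it will be the projection to the quotient, not the nilpotent operator.\<close>

definition lifted_basis :: "'c set \<Rightarrow> bool" where
  "lifted_basis B \<longleftrightarrow> B \<subseteq> carrier V \<and> inj_on T B \<and> W.basis (T ` B)"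

lemma lifted_basis_finite:
  assumes "W.fin_dim" "lifted_basis B"
  shows "finite B" "card B = W.dim"
proof -
  have B: "inj_on T B" "W.basis (T ` B)"
    using assms(2) by (auto simp: lifted_basis_def)
  then have fin: "finite (T ` B)"
    using W.fin_dim_li_fin[OF assms(1)] by (auto simp: W.basis_def)
  then show "finite B" using B(1) finite_imageD by blast
  show "card B = W.dim"
    using W.dim_basis[OF fin B(2)] B(1) by (simp add: card_image)
qed

text \<open>The exchange is made in \<open>W\<close> with the vector \<open>T v\<close>; injectivity
  of \<open>T\<close> on \<open>B\<close> carries it back to \<open>V\<close>.\<close>

lemma lifted_basis_exchange:
  assumes "W.fin_dim" "lifted_basis B" "S \<subseteq> B" "v \<in> carrier V" "T v \<notin> W.module.span (T ` S)"
  obtains b where "b \<in> B - S" "v \<notin> B - {b}" "lifted_basis (insert v (B - {b}))"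
proof -
  have B: "B \<subseteq> carrier V" "inj_on T B" "W.basis (T ` B)"
    using assms(2) by (auto simp: lifted_basis_def)
  obtain c where c: "c \<in> T ` B - T ` S" "T v \<notin> T ` B - {c}"
    "W.basis (insert (T v) (T ` B - {c}))"
    by (rule W.basis_exchange_outside_span[of "T ` B" "T ` S" "T v"])
      (use B assms lifted_basis_finite[OF assms(1,2)] in auto)
  then obtain b where b: "b \<in> B" "b \<notin> S" "c = T b" by auto
  have TB: "T ` (B - {b}) = T ` B - {c}"
    using inj_on_image_set_diff[OF B(2), of B "{b}"] b by auto
  have "inj_on T (insert v (B - {b}))"
    unfolding inj_on_insert using c(2) TB B(2) by (auto intro: inj_on_diff)
  then have "lifted_basis (insert v (B - {b}))"
    using c(3) B(1) assms(4) TB by (auto simp: lifted_basis_def)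
  moreover have "v \<notin> B - {b}" using c(2) TB by blast
  ultimately show thesis using b that by blast
qed

text \<open>The argument is isolated from the nilpotent operator: all it uses of the height
  \<open>h\<close> is that its sublevel sets \<open>F m\<close> are subspaces.\<close>

theorem lifted_basis_min_sum_iff:
  fixes h :: "'c \<Rightarrow> nat" and F :: "nat \<Rightarrow> 'c set"
  assumes fin_dim: "W.fin_dim"
    and F: "\<And>m. submodule K (F m) V"
    and h: "\<And>v m. v \<in> carrier V \<Longrightarrow> h v \<le> m \<longleftrightarrow> v \<in> F m"
    and B: "lifted_basis B"
  shows "(\<forall>C. lifted_basis C \<longrightarrow> sum h B \<le> sum h C) \<longleftrightarrow>
    (\<forall>m. W.module.span (T ` (B \<inter> F m)) = T ` F m)"
proof (intro iffI allI impI)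
  fix m
  assume min: "\<forall>C. lifted_basis C \<longrightarrow> sum h B \<le> sum h C"
  have "W.module.span (T ` (B \<inter> F m)) \<subseteq> T ` F m"
    by (rule W.module.span_is_subset[OF _ submodule_image[OF F]]) auto
  moreover have "T v \<in> W.module.span (T ` (B \<inter> F m))" if v: "v \<in> F m" for v
  proof (rule ccontr)
    assume not_span: "T v \<notin> W.module.span (T ` (B \<inter> F m))"
    have vV: "v \<in> carrier V" using v F[of m] by (auto simp: submodule_def)
    obtain b where b: "b \<in> B - B \<inter> F m" "v \<notin> B - {b}" "lifted_basis (insert v (B - {b}))"
      using lifted_basis_exchange[OF fin_dim B _ vV not_span] by blast
    have "finite B" using lifted_basis_finite[OF fin_dim B] by blast
    then have "sum h (insert v (B - {b})) = h v + sum h (B - {b})"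
      "sum h B = h b + sum h (B - {b})"
      using b by (simp_all add: sum.remove)
    moreover have "sum h B \<le> sum h (insert v (B - {b}))" using min b by blast
    moreover have "h v \<le> m" using h vV v by blast
    moreover have "\<not> h b \<le> m" using h[of b m] b B by (auto simp: lifted_basis_def)
    ultimately show False by linarith
  qed
  ultimately show "W.module.span (T ` (B \<inter> F m)) = T ` F m" by blast
next
  fix C
  assume spans: "\<forall>m. W.module.span (T ` (B \<inter> F m)) = T ` F m" and C: "lifted_basis C"
  have fin: "finite B" "finite C" and card: "card B = card C"
    using lifted_basis_finite[OF fin_dim] B C by auto
  \<comment> \<open>The counted sets are complements of \<open>A \<inter> F m\<close>. As
    \<open>B\<close> and \<open>C\<close> have equal size, bounds on the intersections reverse for
    the complements.\<close>
  have in_F: "{b\<in>A. m < h b} = A - A \<inter> F m" if "lifted_basis A" for A m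
    using h that by (auto simp: lifted_basis_def not_le[symmetric])
  have "card (C \<inter> F m) \<le> card (B \<inter> F m)" for m
  proof -
    have "card (T ` (C \<inter> F m)) \<le> card (T ` (B \<inter> F m))"
    proof (rule W.lin_indpt_card_le_span)
      show "\<not> W.module.lin_dep (T ` (C \<inter> F m))"
        using C W.module.subset_li_is_li[of "T ` C" "T ` (C \<inter> F m)"]
        by (auto simp: lifted_basis_def W.basis_def)
      show "T ` (C \<inter> F m) \<subseteq> W.module.span (T ` (B \<inter> F m))" using spans by auto
      show "T ` (B \<inter> F m) \<subseteq> carrier W" using B by (auto simp: lifted_basis_def)
    qed (use fin in auto)
    moreover have "inj_on T (C \<inter> F m)" "inj_on T (B \<inter> F m)"
      using B C by (auto simp: lifted_basis_def intro: inj_on_subset)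
    ultimately show ?thesis by (simp add: card_image)
  qed
  then have le: "card {b\<in>B. m < h b} \<le> card {b\<in>C. m < h b}" for m
    using in_F[OF B] in_F[OF C] fin card by (simp add: card_Diff_subset diff_le_mono2)
  \<comment> \<open>A common bound for all heights in \<open>B\<close> and \<open>C\<close>, so that
    both sums split over the same range of levels.\<close>
  define N where "N = sum h B + sum h C"
  have "h b \<le> N" if "b \<in> B \<or> b \<in> C" for b
    using that member_le_sum[of b B h] member_le_sum[of b C h] fin by (auto simp: N_def)
  then have "sum h B = (\<Sum>m<N. card {b\<in>B. m < h b})" "sum h C = (\<Sum>m<N. card {b\<in>C. m < h b})"
    using fin by (auto intro: sum_eq_sum_card_less)
  then show "sum h B \<le> sum h C" using le by (simp add: sum_mono)
qed

end

section \<open>Kernels of powers and heights\<close>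

lemma ker_pow_iff:
  assumes "linear_map K V V T"
  shows "v \<in> ker_pow V T m \<longleftrightarrow> v \<in> carrier V \<and> (T ^^ m) v = \<zero>\<^bsub>V\<^esub>"
proof -
  interpret linear_map K V V "T ^^ m" by (rule linear_map_funpow[OF assms])
  show ?thesis by (simp add: ker_def)
qed

lemma ker_pow_submodule:
  assumes "linear_map K V V T"
  shows "submodule K (ker_pow V T m) V"
proof -
  interpret linear_map K V V "T ^^ m" by (rule linear_map_funpow[OF assms])
  show ?thesis by (rule ker_is_submodule)
qed

text \<open>Nilpotency ensures that the least exponent exists and kills \<open>v\<close>; every
  larger power then kills \<open>v\<close> too, since powers of \<open>T\<close> fix zero.\<close>

lemma nil_height_le_iff:
  assumes "linear_map K V V T" "nilpotent_on V T" "v \<in> carrier V"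
  shows "nil_height V T v \<le> m \<longleftrightarrow> v \<in> ker_pow V T m"
proof
  interpret linear_map K V V T by fact
  assume le: "nil_height V T v \<le> m"
  have zero: "(T ^^ k) \<zero>\<^bsub>V\<^esub> = \<zero>\<^bsub>V\<^esub>" for k by (induction k) auto
  obtain n where "(T ^^ n) v = \<zero>\<^bsub>V\<^esub>"
    using assms(2,3) by (auto simp: nilpotent_on_def)
  then have "(T ^^ nil_height V T v) v = \<zero>\<^bsub>V\<^esub>"
    unfolding nil_height_def by (rule LeastI)
  then have "(T ^^ (m - nil_height V T v + nil_height V T v)) v = \<zero>\<^bsub>V\<^esub>"
    by (simp only: funpow_add o_apply zero)
  then show "v \<in> ker_pow V T m" using le assms(3) by (simp add: ker_pow_iff[OF assms(1)])
next
  assume "v \<in> ker_pow V T m"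
  then show "nil_height V T v \<le> m"
    by (auto simp: ker_pow_iff[OF assms(1)] nil_height_def intro: Least_le)
qed

theorem proposition1p0p2:
  fixes V :: "(complex, 'v, 'm) module_scheme" and T :: "'v \<Rightarrow> 'v" and B :: "'v set"
  assumes "vectorspace class_ring V"
    and "vectorspace.fin_dim class_ring V"
    and "linear_map class_ring V V T"
    and "nilpotent_on V T"
    and "q_basis V T B"
  shows "has_min_weight V T B \<longleftrightarrow>
    (\<forall>m. LinearCombinations.module.span class_ring (im_quot V T) (im_proj V T ` (B \<inter> ker_pow V T m))
          = im_proj V T ` ker_pow V T m)"
proof -
  have im: "submodule class_ring (mod_hom.im V T) V"
    using assms(3) mod_hom.im_is_submodule linear_map.axioms(3) by blast
  note q = linear_map_quot_proj[OF assms(1) im]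
  have lifted: "linear_map.lifted_basis class_ring V (im_quot V T) (im_proj V T) C \<longleftrightarrow> q_basis V T C"
    for C
    by (simp only: linear_map.lifted_basis_def[OF q] q_basis_def)
  \<comment> \<open>The quotient is the image of the finite-dimensional \<open>V\<close> under the
    projection.\<close>
  have "vectorspace.fin_dim class_ring (im_quot V T)"
    by (rule linear_map.surj_fin_dim[OF q assms(2) quot_proj_surj])
  \<comment> \<open>The general criterion is applied to the projection, with
    \<open>nil_height V T\<close> as height and \<open>ker_pow V T m\<close> as its sublevel
    sets.\<close>
  from linear_map.lifted_basis_min_sum_iff[OF q this ker_pow_submodule[OF assms(3)]
      nil_height_le_iff[OF assms(3,4)], unfolded lifted, OF _ assms(5)] assms(5)
  show ?thesis
    by (simp only: has_min_weight_def weight_def simp_thms)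
qed

end
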